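(* There is an absolute constant $C>0$ such that for every positive integer $N$ and every Sidon set $S \subset [N]$, $$\sup_{\alpha\in\mathbb{T}}\left|\hat{1}_{S}(\alpha) - \frac{|S|}{N}\hat{1}_{[N]}(\alpha)\right| \leq C\, N^{1/2}\left(\left|\frac{|S|}{N^{1/2}}-1\right|+N^{-1/6}\right)^{1/2}.$$
   Context: $[N]=\{1,2,\dots,N\}$ and $\mathbb{T}=\mathbb{R}/\mathbb{Z}$. A set $S\subset\mathbb{Z}$ is Sidon if every non-zero integer $x$ has at most one representation $x=s_1-s_2$ with $s_1,s_2\in S$. For finitely supported $f:\mathbb{Z}\to\mathbb{C}$, the Fourier transform is $\hat f(\alpha)=\sum_{n\in\mathbb{Z}} f(n)e(\alpha n)$ for $\alpha\in\mathbb{T}$, where $e(\beta)=e^{2\pi i\beta}$. $1_A$ denotes the indicator function of a set $A$. *)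

theory Defs
  imports "HOL-Analysis.Analysis"
begin

definition sidon :: "int set \<Rightarrow> bool" where
  "sidon S \<longleftrightarrow> (\<forall>x. x \<noteq> 0 \<longrightarrow> (\<exists>\<^sub>\<le>\<^sub>1p. p \<in> S \<times> S \<and> x = fst p - snd p))"

definition e :: "real \<Rightarrow> complex" where
  "e \<beta> = exp (2 * of_real pi * \<i> * of_real \<beta>)"

text \<open>Meaningful for finitely supported \<open>f\<close> only. Functions on \<open>\<real>/\<int>\<close> are represented as
  1-periodic functions on \<open>\<real>\<close>; see \<open>fourier_periodic\<close> below.\<close>

definition fourier :: "(int \<Rightarrow> complex) \<Rightarrow> real \<Rightarrow> complex" where
  "fourier f \<alpha> = (\<Sum>n | f n \<noteq> 0. f n * e (\<alpha> * of_int n))"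

lemma fourier_periodic: "fourier f (\<alpha> + of_int k) = fourier f \<alpha>"
proof -
  have "e ((\<alpha> + of_int k) * of_int n) = e (\<alpha> * of_int n)" for n
  proof -
    have "e ((\<alpha> + of_int k) * of_int n)
        = exp (2 * of_real pi * \<i> * of_real (\<alpha> * of_int n) + (2 * of_int (k * n) * pi) * \<i>)"
      unfolding e_def by (simp add: algebra_simps)
    also have "\<dots> = e (\<alpha> * of_int n)"
      unfolding e_def exp_eq by (intro exI[of _ "k * n"]) simp
    finally show ?thesis .
  qed
  then show ?thesis
    by (simp add: fourier_def)
qed

lemma norm_fourier_le: "norm (fourier f \<alpha>) \<le> (\<Sum>n | f n \<noteq> 0. norm (f n))"
  unfolding fourier_def
  by (rule order_trans[OF norm_sum]) (simp add: norm_mult e_def norm_exp_eq_Re)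

text \<open>Boundedness, so that the real-valued \<open>SUP\<close> of such a difference is a genuine supremum.\<close>

lemma bdd_above_fourier_diff:
  "bdd_above (range (\<lambda>\<alpha>. norm (fourier f \<alpha> - c * fourier g \<alpha>)))"
proof (rule bdd_aboveI2)
  fix \<alpha>
  have "norm (fourier f \<alpha> - c * fourier g \<alpha>) \<le> norm (fourier f \<alpha>) + norm c * norm (fourier g \<alpha>)"
    by (metis norm_mult norm_triangle_ineq4)
  also have "\<dots> \<le> (\<Sum>n | f n \<noteq> 0. norm (f n)) + norm c * (\<Sum>n | g n \<noteq> 0. norm (g n))"
    by (intro add_mono mult_left_mono norm_fourier_le norm_ge_zero)
  finally show "norm (fourier f \<alpha> - c * fourier g \<alpha>)
    \<le> (\<Sum>n | f n \<noteq> 0. norm (f n)) + norm c * (\<Sum>n | g n \<noteq> 0. norm (g n))" .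
qed

end

theory Submission
  imports Defs
begin

text \<open>Van der Corput's method. Smooth \<open>e (\<alpha> n)\<close> over \<open>S\<close> by windows of length
  \<open>H \<approx> N\<^sup>2\<^sup>/\<^sup>3\<close>. The energy of the window sums is a Fejer sum over the differences of \<open>S\<close>; for
  a Sidon set each nonzero difference occurs at most once, and Cauchy--Schwarz at frequency \<open>0\<close>
  shows that, when \<open>|S|\<close> is close to \<open>\<surd>N\<close>, almost all differences below \<open>H\<close> occur. Hence the
  energy at every frequency is close to that of the full Fejer kernel, and subtracting from each
  window sum its expected value \<open>|S| / N\<close> times a Dirichlet sum leaves little energy. A final
  Cauchy--Schwarz over the windows recovers the Fourier coefficient.\<close>

section \<open>Additive characters\<close>

lemma e_add: "e (x + y) = e x * e y"
  by (simp add: e_def exp_add algebra_simps)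

lemma cnj_e: "cnj (e x) = e (- x)"
  by (simp add: e_def exp_cnj)

lemma norm_e [simp]: "norm (e x) = 1"
  by (simp add: e_def norm_exp_eq_Re)

lemma e_0 [simp]: "e 0 = 1"
  by (simp add: e_def)

lemma e_mult_cnj_e: "e (\<alpha> * of_int m) * cnj (e (\<alpha> * of_int n)) = e (\<alpha> * of_int (m - n))"
  by (simp add: cnj_e flip: e_add) (simp add: algebra_simps)

lemma fourier_indicator:
  "finite S \<Longrightarrow> fourier (indicator S) \<alpha> = (\<Sum>n\<in>S. e (\<alpha> * of_int n))"
  unfolding fourier_def by (rule sum.cong) (auto simp: indicator_def)

section \<open>Window sums and the Fejer kernel\<close>

text \<open>The number of integers common to two windows of length \<open>H\<close> whose starting
  points differ by \<open>d\<close>: an unnormalised Fejer coefficient. Truncation at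
  \<open>0\<close> covers disjoint windows.\<close>

definition fejer_weight :: "int \<Rightarrow> int \<Rightarrow> real" where
  "fejer_weight H d = of_int (max 0 (H - \<bar>d\<bar>))"

text \<open>Windows run forward from the elements of \<open>S\<close>, so \<open>x\<close> collects
  the \<open>n\<close> with \<open>x - H < n \<le> x\<close>. Each term keeps the phase of
  \<open>n\<close>, not of \<open>x\<close>.\<close>

definition window_sum :: "int \<Rightarrow> int set \<Rightarrow> real \<Rightarrow> int \<Rightarrow> complex" where
  "window_sum H S \<alpha> x = (\<Sum>n\<in>S. of_bool (x \<in> {n..<n + H}) * e (\<alpha> * of_int n))"

definition dirichlet :: "int \<Rightarrow> real \<Rightarrow> complex" where
  "dirichlet H \<alpha> = (\<Sum>j\<in>{0..<H}. e (\<alpha> * of_int j))"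

lemma fejer_weight_nonneg: "fejer_weight H d \<ge> 0"
  by (simp add: fejer_weight_def)

lemma card_window_Int: "real (card ({m..<m + H} \<inter> {n..<n + H})) = fejer_weight H (m - n)"
  by (simp add: fejer_weight_def of_nat_nat)

text \<open>Expand the square and sum over \<open>x\<close> first: a pair \<open>(m, n)\<close> is
  counted once for every point in both windows. Since \<open>X\<close> contains every window
  completely, this count depends only on \<open>m - n\<close>.\<close>

lemma sum_norm_window_sum:
  assumes "finite S" "finite X" "\<And>n. n \<in> S \<Longrightarrow> {n..<n + H} \<subseteq> X"
  shows "complex_of_real (\<Sum>x\<in>X. (norm (window_sum H S \<alpha> x))\<^sup>2)
    = (\<Sum>(m, n)\<in>S \<times> S. of_real (fejer_weight H (m - n)) * e (\<alpha> * of_int (m - n)))"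
proof -
  let ?i = "\<lambda>n x. of_bool (x \<in> {n..<n + H}) :: complex"
  have "complex_of_real (\<Sum>x\<in>X. (norm (window_sum H S \<alpha> x))\<^sup>2)
      = (\<Sum>x\<in>X. window_sum H S \<alpha> x * cnj (window_sum H S \<alpha> x))"
    by (simp add: complex_norm_square del: of_real_power)
  also have "\<dots> = (\<Sum>x\<in>X. \<Sum>m\<in>S. \<Sum>n\<in>S. ?i m x * ?i n x * e (\<alpha> * of_int (m - n)))"
  proof (intro sum.cong refl)
    fix x
    have "(?i m x * e (\<alpha> * of_int m)) * cnj (?i n x * e (\<alpha> * of_int n))
        = ?i m x * ?i n x * e (\<alpha> * of_int (m - n))" for m n
      by (auto simp: e_mult_cnj_e simp del: of_int_diff)
    then show "window_sum H S \<alpha> x * cnj (window_sum H S \<alpha> x)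
        = (\<Sum>m\<in>S. \<Sum>n\<in>S. ?i m x * ?i n x * e (\<alpha> * of_int (m - n)))"
      by (simp only: window_sum_def cnj_sum sum_product)
  qed
  also have "\<dots> = (\<Sum>m\<in>S. \<Sum>n\<in>S. (\<Sum>x\<in>X. ?i m x * ?i n x) * e (\<alpha> * of_int (m - n)))"
    unfolding sum_distrib_right
    by (subst sum.swap, rule sum.cong[OF refl], rule sum.swap)
  also have "\<dots> = (\<Sum>m\<in>S. \<Sum>n\<in>S. of_real (fejer_weight H (m - n)) * e (\<alpha> * of_int (m - n)))"
  proof (intro sum.cong refl arg_cong2[where f = "(*)"])
    fix m n assume "m \<in> S" "n \<in> S"
    have "(\<Sum>x\<in>X. ?i m x * ?i n x) = (\<Sum>x\<in>X. of_bool (x \<in> {m..<m + H} \<inter> {n..<n + H}))"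
      by (intro sum.cong) auto
    also have "\<dots> = of_nat (card ({m..<m + H} \<inter> {n..<n + H} \<inter> X))"
      using assms(2) by (simp add: Int_def conj_ac)
    also have "{m..<m + H} \<inter> {n..<n + H} \<inter> X = {m..<m + H} \<inter> {n..<n + H}"
      using assms(3)[OF \<open>m \<in> S\<close>] by auto
    finally show "(\<Sum>x\<in>X. ?i m x * ?i n x) = of_real (fejer_weight H (m - n))"
      by (simp flip: card_window_Int)
  qed
  finally show ?thesis
    by (simp add: sum.cartesian_product)
qed

text \<open>The same Fejer weights with every difference below \<open>H\<close> present: the full
  sum against which the energy of a Sidon set is compared.\<close>

lemma norm_dirichlet_square:
  "complex_of_real ((norm (dirichlet H \<alpha>))\<^sup>2)
    = (\<Sum>d\<in>{-H<..<H}. of_real (fejer_weight H d) * e (\<alpha> * of_int d))"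
proof -
  let ?I = "{0..<H}"
  have "complex_of_real ((norm (dirichlet H \<alpha>))\<^sup>2)
      = (\<Sum>p\<in>?I \<times> ?I. e (\<alpha> * of_int (fst p - snd p)))"
    by (simp add: complex_norm_square dirichlet_def sum_product e_mult_cnj_e sum.cartesian_product
        case_prod_unfold del: of_real_power of_int_diff)
  also have "\<dots> = (\<Sum>d\<in>{-H<..<H}. \<Sum>p | p \<in> ?I \<times> ?I \<and> fst p - snd p = d.
      e (\<alpha> * of_int (fst p - snd p)))"
    by (rule sum.group[symmetric]) auto
  also have "\<dots> = (\<Sum>d\<in>{-H<..<H}. of_real (fejer_weight H d) * e (\<alpha> * of_int d))"
  proof (intro sum.cong refl)
    fix d :: int
    \<comment> \<open>A pair with difference \<open>d\<close> is determined by its first entry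
      \<open>k\<close>, where \<open>k\<close> and \<open>k - d\<close> both lie in
      \<open>?I\<close>. The form \<open>0 + H\<close> lets \<open>card_window_Int\<close>
      match.\<close>
    have "bij_betw (\<lambda>k. (k, k - d)) ({0..<0 + H} \<inter> {d..<d + H}) {p \<in> ?I \<times> ?I. fst p - snd p = d}"
      by (rule bij_betwI[where g = fst]) auto
    then have "real (card {p \<in> ?I \<times> ?I. fst p - snd p = d}) = fejer_weight H (0 - d)"
      by (simp only: bij_betw_same_card[symmetric] card_window_Int)
    then have card: "fejer_weight H d = real (card {p \<in> ?I \<times> ?I. fst p - snd p = d})"
      by (simp add: fejer_weight_def)
    have "(\<Sum>p | p \<in> ?I \<times> ?I \<and> fst p - snd p = d. e (\<alpha> * of_int (fst p - snd p)))
        = (\<Sum>p | p \<in> ?I \<times> ?I \<and> fst p - snd p = d. e (\<alpha> * of_int d))"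
      by (rule sum.cong) (simp_all only: mem_Collect_eq)
    then show "(\<Sum>p | p \<in> ?I \<times> ?I \<and> fst p - snd p = d. e (\<alpha> * of_int (fst p - snd p)))
        = of_real (fejer_weight H d) * e (\<alpha> * of_int d)"
      unfolding card sum_constant of_real_of_nat_eq by simp
  qed
  finally show ?thesis .
qed

section \<open>Window energy of Sidon sets\<close>

text \<open>Uniqueness of representations, in the form that lets a sum over pairs be reindexed by
  differences.\<close>

lemma sidon_inj_on_diff:
  assumes "sidon S"
  shows "inj_on (\<lambda>(m, n). m - n) (S \<times> S - Id)"
proof (rule inj_onI)
  fix p q assume p: "p \<in> S \<times> S - Id" and q: "q \<in> S \<times> S - Id"
    and eq: "(case p of (m, n) \<Rightarrow> m - n) = (case q of (m, n) \<Rightarrow> m - n)"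
  then have "fst p - snd p \<noteq> 0"
    by auto
  then have "\<exists>\<^sub>\<le>\<^sub>1r. r \<in> S \<times> S \<and> fst p - snd p = fst r - snd r"
    using assms unfolding sidon_def by blast
  then show "p = q"
    by (rule Uniq_D) (use p q eq in \<open>simp_all add: case_prod_unfold\<close>)
qed

text \<open>Off the diagonal, the energy of the window sums is a part of the Fejer sum whose
  complement is controlled by its value at frequency \<open>0\<close>.\<close>

lemma sidon_window_energy:
  assumes S: "finite S" "sidon S" and X: "finite X" "\<And>n. n \<in> S \<Longrightarrow> {n..<n + H} \<subseteq> X"
    and H: "H \<ge> 0"
  shows "(\<Sum>x\<in>X. (norm (window_sum H S \<alpha> x))\<^sup>2)
    \<le> (norm (dirichlet H \<alpha>))\<^sup>2 + (of_int H)\<^sup>2 - 2 * of_int H + 2 * of_int H * real (card S)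
      - (\<Sum>x\<in>X. (norm (window_sum H S 0 x))\<^sup>2)"
proof -
  define t where "t = (\<lambda>\<beta> d. of_real (fejer_weight H d) * e (\<beta> * of_int d))"
  define L where "L = {-H<..<H} - {0}"
  define P where "P = {p \<in> S \<times> S - Id. fst p - snd p \<in> L}"
  define \<Delta> where "\<Delta> = (\<lambda>(m, n). m - n) ` P"
  have fin: "finite P" "finite L"
    using S by (auto simp: P_def L_def)
  have sub: "\<Delta> \<subseteq> L"
    by (auto simp: \<Delta>_def P_def)
  have t0: "t \<beta> 0 = of_int H" for \<beta>
    using H by (simp add: t_def fejer_weight_def)
  \<comment> \<open>The diagonal contributes \<open>H\<close> for each element of \<open>S\<close>.
    Off it, differences outside \<open>L\<close> have weight \<open>0\<close>, and injectivity turns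
    the remaining pairs into distinct differences.\<close>
  have F: "complex_of_real (\<Sum>x\<in>X. (norm (window_sum H S \<beta> x))\<^sup>2)
      = of_int H * of_nat (card S) + (\<Sum>d\<in>\<Delta>. t \<beta> d)" for \<beta>
  proof -
    have "(\<Sum>(m, n)\<in>S \<times> S. t \<beta> (m - n))
        = (\<Sum>(m, n)\<in>S \<times> S \<inter> Id. t \<beta> (m - n)) + (\<Sum>(m, n)\<in>S \<times> S - Id. t \<beta> (m - n))"
      using S(1) by (subst sum.Int_Diff[where B = Id]) auto
    also have "(\<Sum>(m, n)\<in>S \<times> S - Id. t \<beta> (m - n)) = (\<Sum>(m, n)\<in>P. t \<beta> (m - n))"
      by (rule sum.mono_neutral_right)
        (use S(1) in \<open>auto simp: P_def L_def t_def fejer_weight_def\<close>)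
    also have "\<dots> = (\<Sum>d\<in>\<Delta>. t \<beta> d)"
      unfolding \<Delta>_def using inj_on_subset[OF sidon_inj_on_diff[OF S(2)], of P]
      by (subst sum.reindex) (auto simp: P_def case_prod_unfold)
    also have "S \<times> S \<inter> Id = (\<lambda>n. (n, n)) ` S"
      by auto
    also have "(\<Sum>(m, n)\<in>(\<lambda>n. (n, n)) ` S. t \<beta> (m - n)) = of_int H * of_nat (card S)"
      by (subst sum.reindex) (auto simp: inj_on_def t0)
    finally show ?thesis
      by (simp add: sum_norm_window_sum[OF S(1) X] t_def del: of_real_sum of_int_diff)
  qed
  have D: "complex_of_real ((norm (dirichlet H \<beta>))\<^sup>2) = of_int H + (\<Sum>d\<in>L. t \<beta> d)" for \<beta>
  proof (cases "H = 0")
    \<comment> \<open>For \<open>H = 0\<close> the interval \<open>{-H<..<H}\<close> is empty, so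
      the term \<open>d = 0\<close> cannot be split off; there both sides vanish.\<close>
    case False
    then have "(\<Sum>d\<in>{-H<..<H}. t \<beta> d) = t \<beta> 0 + (\<Sum>d\<in>L. t \<beta> d)"
      unfolding L_def using H by (subst sum.remove[of _ 0]) auto
    then show ?thesis
      unfolding norm_dirichlet_square t0 by (simp add: t_def)
  qed (simp add: dirichlet_def L_def)
  have split: "(\<Sum>d\<in>L. t \<beta> d) - (\<Sum>d\<in>\<Delta>. t \<beta> d) = (\<Sum>d\<in>L - \<Delta>. t \<beta> d)" for \<beta>
    using sum.subset_diff[OF sub fin(2), of "t \<beta>"] by simp
  let ?F = "\<lambda>\<beta>. \<Sum>x\<in>X. (norm (window_sum H S \<beta> x))\<^sup>2"
  \<comment> \<open>With both diagonals removed, \<open>?E\<close> is the Fejer sum over the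
    differences in \<open>L\<close> that \<open>S\<close> misses. Its coefficients are nonnegative,
    so its modulus is largest at frequency \<open>0\<close>.\<close>
  let ?E = "\<lambda>\<beta>. (norm (dirichlet H \<beta>))\<^sup>2 - of_int H - (?F \<beta> - of_int H * real (card S))"
  have E: "complex_of_real (?E \<beta>) = (\<Sum>d\<in>L - \<Delta>. t \<beta> d)" for \<beta>
    unfolding split[symmetric] using F[of \<beta>] D[of \<beta>] by (simp del: of_real_sum of_real_power)
  have E0: "?E 0 = (\<Sum>d\<in>L - \<Delta>. fejer_weight H d)"
  proof -
    have "complex_of_real (?E 0) = of_real (\<Sum>d\<in>L - \<Delta>. fejer_weight H d)"
      unfolding E by (simp add: t_def)
    then show ?thesis
      unfolding of_real_eq_iff .
  qed
  have "\<bar>?E \<alpha>\<bar> = norm (\<Sum>d\<in>L - \<Delta>. t \<alpha> d)"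
    unfolding E[symmetric] norm_of_real ..
  also have "\<dots> \<le> (\<Sum>d\<in>L - \<Delta>. fejer_weight H d)"
    by (rule sum_norm_le) (simp add: t_def norm_mult fejer_weight_nonneg)
  finally have "\<bar>?E \<alpha>\<bar> \<le> ?E 0"
    unfolding E0 .
  moreover have "norm (dirichlet H 0) = of_int H"
    using H by (simp add: dirichlet_def)
  ultimately show ?thesis
    by (simp add: abs_le_iff algebra_simps)
qed

section \<open>Comparison of window sums with a uniform density\<close>

lemma sum_square_le_card_mult:
  fixes f :: "'a \<Rightarrow> real"
  shows "(\<Sum>x\<in>A. f x)\<^sup>2 \<le> real (card A) * (\<Sum>x\<in>A. (f x)\<^sup>2)"
  using Cauchy_Schwarz_ineq_sum[of "\<lambda>_. 1" f A] by simp

lemma norm_sum_square_le_card_mult: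
  fixes f :: "'a \<Rightarrow> 'b::real_normed_vector"
  shows "(norm (\<Sum>x\<in>A. f x))\<^sup>2 \<le> real (card A) * (\<Sum>x\<in>A. (norm (f x))\<^sup>2)"
  using power_mono[OF norm_sum[of f A] norm_ge_zero, of 2]
    sum_square_le_card_mult[of "\<lambda>x. norm (f x)" A] by (rule order_trans)

text \<open>Double counting: sum over the elements of \<open>S\<close> first and write
  \<open>x = n + j\<close>. A general \<open>g\<close> serves both the plain and the twisted sum of
  window sums.\<close>

lemma sum_windows:
  fixes g :: "int \<Rightarrow> int \<Rightarrow> complex"
  assumes "finite X" "\<And>n. n \<in> S \<Longrightarrow> {n..<n + H} \<subseteq> X"
  shows "(\<Sum>x\<in>X. \<Sum>n\<in>S. of_bool (x \<in> {n..<n + H}) * g n x) = (\<Sum>n\<in>S. \<Sum>j\<in>{0..<H}. g n (n + j))"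
proof (subst sum.swap, rule sum.cong[OF refl])
  fix n assume "n \<in> S"
  have "(\<Sum>x\<in>X. of_bool (x \<in> {n..<n + H}) * g n x) = (\<Sum>x\<in>{n..<n + H}. g n x)"
    by (rule sum.mono_neutral_cong_right) (use assms(1) assms(2)[OF \<open>n \<in> S\<close>] in auto)
  also have "\<dots> = (\<Sum>j\<in>{0..<H}. g n (n + j))"
    by (rule sum.reindex_bij_witness[of _ "\<lambda>j. n + j" "\<lambda>x. x - n"]) auto
  finally show "(\<Sum>x\<in>X. of_bool (x \<in> {n..<n + H}) * g n x) = (\<Sum>j\<in>{0..<H}. g n (n + j))" .
qed

text \<open>Each element of \<open>S\<close> is seen from \<open>H\<close> positions. This recovers
  the Fourier coefficient from the windows.\<close>

lemma sum_window_sum: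
  assumes "finite X" "\<And>n. n \<in> S \<Longrightarrow> {n..<n + H} \<subseteq> X" "H \<ge> 0"
  shows "(\<Sum>x\<in>X. window_sum H S \<alpha> x) = of_int H * (\<Sum>n\<in>S. e (\<alpha> * of_int n))"
  unfolding window_sum_def using assms by (subst sum_windows) (auto simp: sum_distrib_left)

text \<open>With \<open>x = n + j\<close> the phase becomes \<open>- \<alpha> * j\<close>,
  independent of \<open>n\<close>, so the sum factors. It is the cross term when window sums are
  compared with a multiple of the character.\<close>

lemma sum_window_sum_cnj_e:
  assumes "finite X" "\<And>n. n \<in> S \<Longrightarrow> {n..<n + H} \<subseteq> X"
  shows "(\<Sum>x\<in>X. window_sum H S \<alpha> x * cnj (e (\<alpha> * of_int x)))
    = of_nat (card S) * cnj (dirichlet H \<alpha>)"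
proof -
  have "(\<Sum>x\<in>X. window_sum H S \<alpha> x * cnj (e (\<alpha> * of_int x)))
      = (\<Sum>x\<in>X. \<Sum>n\<in>S. of_bool (x \<in> {n..<n + H}) * e (\<alpha> * of_int (n - x)))"
    by (simp add: window_sum_def sum_distrib_right mult.assoc e_mult_cnj_e del: of_int_diff)
  also have "\<dots> = (\<Sum>n\<in>S. \<Sum>j\<in>{0..<H}. e (\<alpha> * of_int (n - (n + j))))"
    using assms by (rule sum_windows)
  finally show ?thesis
    by (simp add: dirichlet_def cnj_e)
qed

lemma norm_dirichlet_le: "H \<ge> 0 \<Longrightarrow> norm (dirichlet H \<alpha>) \<le> of_int H"
  unfolding dirichlet_def by (rule order_trans[OF norm_sum]) simp

text \<open>The subtracted term is the window sum of a constant density \<open>c\<close> on all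
  integers, since there \<open>n = x - j\<close> with \<open>0 \<le> j < H\<close>. Expanding the
  square, the cross term is evaluated exactly.\<close>

lemma sum_norm_square_window_deviation:
  assumes X: "finite X" "\<And>n. n \<in> S \<Longrightarrow> {n..<n + H} \<subseteq> X"
  shows "(\<Sum>x\<in>X. (norm (window_sum H S \<alpha> x
        - of_real c * cnj (dirichlet H \<alpha>) * e (\<alpha> * of_int x)))\<^sup>2)
    = (\<Sum>x\<in>X. (norm (window_sum H S \<alpha> x))\<^sup>2)
      - (norm (dirichlet H \<alpha>))\<^sup>2 * (2 * c * real (card S) - c\<^sup>2 * real (card X))"
proof -
  let ?D = "dirichlet H \<alpha>" and ?F = "window_sum H S \<alpha>"
  have "(norm (?F x - of_real c * cnj ?D * e (\<alpha> * of_int x)))\<^sup>2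
      = (norm (?F x))\<^sup>2 - 2 * c * Re (?D * (?F x * cnj (e (\<alpha> * of_int x)))) + c\<^sup>2 * (norm ?D)\<^sup>2" for x
  proof -
    have "(norm (u - v))\<^sup>2 = (norm u)\<^sup>2 - 2 * Re (u * cnj v) + (norm v)\<^sup>2" for u v :: complex
      by (simp add: cmod_power2) (simp add: power2_eq_square algebra_simps)
    moreover have "?F x * cnj (of_real c * cnj ?D * e (\<alpha> * of_int x))
        = of_real c * (?D * (?F x * cnj (e (\<alpha> * of_int x))))"
      by (simp add: mult_ac)
    moreover have "Re (of_real c * z) = c * Re z" for z
      by simp
    ultimately show ?thesis
      by (simp only: norm_mult norm_e norm_of_real complex_mod_cnj power_mult_distrib) simp
  qed
  then have "(\<Sum>x\<in>X. (norm (?F x - of_real c * cnj ?D * e (\<alpha> * of_int x)))\<^sup>2)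
      = (\<Sum>x\<in>X. (norm (?F x))\<^sup>2)
        - 2 * c * Re (?D * (\<Sum>x\<in>X. ?F x * cnj (e (\<alpha> * of_int x)))) + real (card X) * (c\<^sup>2 * (norm ?D)\<^sup>2)"
    by (simp only: sum.distrib sum_subtractf sum_constant flip: sum_distrib_left Re_sum)
  also have "?D * (\<Sum>x\<in>X. ?F x * cnj (e (\<alpha> * of_int x))) = of_real (real (card S) * (norm ?D)\<^sup>2)"
    by (subst sum_window_sum_cnj_e[where S = S and H = H and X = X, OF X])
      (simp_all add: complex_norm_square del: of_real_power)
  finally show ?thesis
    by (simp add: algebra_simps)
qed

text \<open>Multiplying by \<open>cnj (e (\<alpha> * j))\<close> shifts the interval by
  \<open>j\<close>. For \<open>0 \<le> j < H\<close> the shifted interval still contains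
  \<open>{1..int N}\<close>, with \<open>H - 1\<close> further points; these errors are summed over
  the \<open>H\<close> values of \<open>j\<close>.\<close>

lemma norm_dirichlet_mult_sum_diff_le:
  assumes "H \<ge> 1"
  shows "norm (cnj (dirichlet H \<alpha>) * (\<Sum>x\<in>{1..int N + H - 1}. e (\<alpha> * of_int x))
      - of_int H * (\<Sum>n\<in>{1..int N}. e (\<alpha> * of_int n))) \<le> of_int H * of_int H"
proof -
  let ?a = "\<lambda>n. e (\<alpha> * of_int n)"
  have shift: "cnj (?a j) * (\<Sum>x\<in>{1..int N + H - 1}. ?a x) = (\<Sum>n\<in>{1 - j..int N + H - 1 - j}. ?a n)" for j
  proof -
    have "cnj (?a j) * (\<Sum>x\<in>{1..int N + H - 1}. ?a x) = (\<Sum>x\<in>{1..int N + H - 1}. ?a (x - j))"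
      by (simp add: sum_distrib_left mult.commute[of "cnj _"] e_mult_cnj_e del: of_int_diff)
    also have "\<dots> = (\<Sum>n\<in>{1 - j..int N + H - 1 - j}. ?a n)"
      by (rule sum.reindex_bij_witness[of _ "\<lambda>n. n + j" "\<lambda>x. x - j"]) auto
    finally show ?thesis .
  qed
  have "norm ((\<Sum>n\<in>{1 - j..int N + H - 1 - j}. ?a n) - (\<Sum>n\<in>{1..int N}. ?a n)) \<le> of_int H"
    if j: "j \<in> {0..<H}" for j
  proof -
    let ?B = "{1 - j..int N + H - 1 - j}"
    have sub: "{1..int N} \<subseteq> ?B"
      using j by auto
    have "norm ((\<Sum>n\<in>?B. ?a n) - (\<Sum>n\<in>{1..int N}. ?a n)) = norm (\<Sum>n\<in>?B - {1..int N}. ?a n)"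
      using sum.subset_diff[OF sub, of ?a] by simp
    also have "\<dots> \<le> real (card (?B - {1..int N}))"
      by (rule order_trans[OF norm_sum]) simp
    also have "\<dots> \<le> of_int H"
      using assms sub by (subst card_Diff_subset) auto
    finally show ?thesis .
  qed
  then have "norm (\<Sum>j\<in>{0..<H}. (\<Sum>n\<in>{1 - j..int N + H - 1 - j}. ?a n) - (\<Sum>n\<in>{1..int N}. ?a n))
      \<le> (\<Sum>j\<in>{0..<H}. of_int H)"
    by (rule sum_norm_le)
  also have "(\<Sum>j\<in>{0..<H}. (\<Sum>n\<in>{1 - j..int N + H - 1 - j}. ?a n) - (\<Sum>n\<in>{1..int N}. ?a n))
      = cnj (dirichlet H \<alpha>) * (\<Sum>x\<in>{1..int N + H - 1}. ?a x) - of_int H * (\<Sum>n\<in>{1..int N}. ?a n)"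
    using assms by (simp add: dirichlet_def sum_distrib_right sum_subtractf flip: shift)
  finally show ?thesis
    using assms by simp
qed

section \<open>Energy at frequency 0 and the size of Sidon sets\<close>

lemma windows_subset:
  "S \<subseteq> {1..int N} \<Longrightarrow> n \<in> S \<Longrightarrow> {n..<n + H} \<subseteq> {1..int N + H - 1}"
  by auto

text \<open>Cauchy--Schwarz over the \<open>N + H - 1\<close> window positions. Energy at frequency
  \<open>0\<close> enters \<open>sidon_window_energy\<close> with a minus sign, so a lower bound for
  it helps at every frequency.\<close>

lemma window_count_square_ge:
  assumes "S \<subseteq> {1..int N}" "H \<ge> 1"
  shows "(of_int H * real (card S))\<^sup>2
    \<le> (real N + of_int H - 1) * (\<Sum>x\<in>{1..int N + H - 1}. (norm (window_sum H S 0 x))\<^sup>2)"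
proof -
  have "(\<Sum>x\<in>{1..int N + H - 1}. window_sum H S 0 x) = of_int H * of_nat (card S)"
    using assms by (subst sum_window_sum) auto
  then show ?thesis
    using norm_sum_square_le_card_mult[of "window_sum H S 0" "{1..int N + H - 1}"] assms(2)
    by (simp add: norm_mult)
qed

text \<open>Windows of length \<open>H = N\<close> at frequency \<open>0\<close> give
  \<open>s\<^sup>2 \<le> 2 * N + 2 * s\<close> for the size \<open>s\<close>, which fails beyond
  \<open>3 * sqrt N\<close>.\<close>

lemma sidon_card_le:
  assumes "S \<subseteq> {1..int N}" "sidon S" "N \<ge> 1"
  shows "real (card S) \<le> 3 * sqrt (real N)"
proof (rule ccontr)
  let ?s = "real (card S)" and ?X = "{1..int N + int N - 1}"
  let ?Q = "\<Sum>x\<in>?X. (norm (window_sum (int N) S 0 x))\<^sup>2"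
  have finS: "finite S"
    using assms(1) finite_subset by blast
  have "norm (dirichlet (int N) 0) = real N"
    by (simp add: dirichlet_def)
  \<comment> \<open>At frequency \<open>0\<close> the energy stands on both sides of
    \<open>sidon_window_energy\<close>, so the inequality is halved.\<close>
  then have Q: "?Q \<le> (real N)\<^sup>2 + real N * ?s"
    using sidon_window_energy[OF finS assms(2) _ windows_subset[OF assms(1)], of "int N" 0] by simp
  have "(real N * ?s)\<^sup>2 \<le> (real N + real N - 1) * ?Q"
    using window_count_square_ge[OF assms(1), of "int N"] assms(3) by simp
  also have "\<dots> \<le> (2 * real N) * ((real N)\<^sup>2 + real N * ?s)"
    using Q assms(3) by (intro mult_mono) (auto intro: sum_nonneg)
  finally have "(real N)\<^sup>2 * (?s * ?s) \<le> (real N)\<^sup>2 * (2 * real N + 2 * ?s)"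
    by (simp add: power2_eq_square algebra_simps)
  then have "?s * ?s \<le> 2 * real N + 2 * ?s"
    using assms(3) by (subst (asm) mult_le_cancel_left_pos) auto
  then have le: "?s * (?s - 2) \<le> 2 * (sqrt (real N) * sqrt (real N))"
    by (simp add: algebra_simps)
  assume "\<not> ?s \<le> 3 * sqrt (real N)"
  moreover have "sqrt (real N) \<ge> 1"
    using assms(3) by simp
  ultimately have "3 * sqrt (real N) \<le> ?s" "sqrt (real N) \<le> ?s - 2"
    by linarith+
  then have "(3 * sqrt (real N)) * sqrt (real N) \<le> ?s * (?s - 2)"
    by (intro mult_mono) auto
  with le have "sqrt (real N) * sqrt (real N) \<le> 0"
    by linarith
  then show False
    using assms(3) by simp
qed

section \<open>Fourier deviation for an arbitrary window length\<close>

text \<open>Under the root, the first term measures the distance of \<open>s\<close> from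
  \<open>sqrt N\<close>, the term with \<open>h / N\<close> comes from windows overhanging the
  interval, and \<open>s / h\<close> from the diagonal. The summand outside is the end error for the
  interval sum.\<close>

lemma sidon_fourier_deviation:
  fixes N :: nat and H :: int and S :: "int set" and \<alpha> s h :: real
  assumes S: "S \<subseteq> {1..int N}" "sidon S" and N: "N \<ge> 1" and H: "H \<ge> 1"
  defines "s \<equiv> real (card S)" and "h \<equiv> real_of_int H"
  shows "norm ((\<Sum>n\<in>S. e (\<alpha> * of_int n)) - of_real (s / N) * (\<Sum>n\<in>{1..int N}. e (\<alpha> * of_int n)))
    \<le> sqrt (2 * (N + h) * (\<bar>1 - s\<^sup>2 / N\<bar> + s\<^sup>2 / N * (h / N) + s / h)) + s / N * h"
proof -
  define c where "c = s / N"
  define u where "u = s\<^sup>2 / N"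
  define X where "X = {1..int N + H - 1}"
  define D where "D = dirichlet H \<alpha>"
  define G where "G = (\<lambda>x. window_sum H S \<alpha> x - of_real c * cnj D * e (\<alpha> * of_int x))"
  define V where "V = (\<Sum>x\<in>X. (norm (G x))\<^sup>2)"
  define Q where "Q = (\<Sum>x\<in>X. (norm (window_sum H S 0 x))\<^sup>2)"
  define A where "A = \<bar>1 - u\<bar> + u * (h / N)"
  define fS where "fS = (\<Sum>n\<in>S. e (\<alpha> * of_int n))"
  define fN where "fN = (\<Sum>n\<in>{1..int N}. e (\<alpha> * of_int n))"
  have finS: "finite S" and finX: "finite X"
    using S(1) finite_subset X_def by auto
  have X: "\<And>n. n \<in> S \<Longrightarrow> {n..<n + H} \<subseteq> X"
    unfolding X_def by (rule windows_subset[OF S(1)])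
  have cardX: "real (card X) = N + h - 1"
    using H by (simp add: X_def h_def)
  have pos: "real N \<ge> 1" "h \<ge> 1" "s \<ge> 0" "c \<ge> 0" "u \<ge> 0"
    using N H by (auto simp: h_def s_def c_def u_def)

  have Q_ge: "h\<^sup>2 * (u - u * (h / N)) \<le> Q"
  proof -
    have "(h * s)\<^sup>2 \<le> (N + h - 1) * Q"
      using window_count_square_ge[OF S(1) H] by (simp add: h_def s_def Q_def X_def)
    moreover have "(N + h - 1) * (h\<^sup>2 * (u - u * (h / N))) \<le> (h * s)\<^sup>2"
    proof -
      \<comment> \<open>The product equals \<open>N - 1 - (h\<^sup>2 - h) / N\<close>, and
        \<open>h \<ge> 1\<close>. It linearises the division by \<open>N + h - 1\<close>.\<close>
      have "(N + h - 1) * (1 - h / N) \<le> N"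
        using pos mult_left_mono[of 1 h h] by (simp add: field_simps add_increasing)
      then have "(N + h - 1) * (1 - h / N) * (h\<^sup>2 * u) \<le> N * (h\<^sup>2 * u)"
        using pos by (intro mult_right_mono) auto
      also have "\<dots> = (h * s)\<^sup>2"
        using pos by (simp add: u_def power_mult_distrib)
      finally show ?thesis
        by (simp only: right_diff_distrib mult_1_right mult_ac)
    qed
    ultimately have "(N + h - 1) * (h\<^sup>2 * (u - u * (h / N))) \<le> (N + h - 1) * Q"
      by linarith
    then show ?thesis
      using pos by simp
  qed
  have V_le: "V \<le> 2 * h\<^sup>2 * (A + s / h)"
  proof -
    have "V = (\<Sum>x\<in>X. (norm (window_sum H S \<alpha> x))\<^sup>2)
        - (norm D)\<^sup>2 * (2 * c * s - c\<^sup>2 * (N + h - 1))"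
      unfolding V_def G_def D_def s_def cardX[symmetric]
      by (rule sum_norm_square_window_deviation[OF finX X])
    also have "\<dots> \<le> (norm D)\<^sup>2 * (1 - 2 * c * s + c\<^sup>2 * (N + h - 1)) + h\<^sup>2 + 2 * h * s - Q"
      using sidon_window_energy[OF finS S(2) finX X, of \<alpha>] H pos
      by (simp add: D_def Q_def h_def s_def algebra_simps)
    also have "1 - 2 * c * s + c\<^sup>2 * (N + h - 1) = 1 - u + u * ((h - 1) / N)"
      using pos by (simp add: c_def u_def field_simps power2_eq_square)
    \<comment> \<open>The coefficient may be negative, so it is replaced by the nonnegative
      \<open>A\<close> before \<open>norm D\<close> is replaced by \<open>h\<close>.\<close>
    also have "(norm D)\<^sup>2 * (1 - u + u * ((h - 1) / N)) \<le> h\<^sup>2 * A"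
    proof -
      have "1 - u + u * ((h - 1) / N) \<le> A"
        unfolding A_def using pos by (intro add_mono mult_left_mono divide_right_mono) auto
      moreover have "A \<ge> 0"
        using pos by (simp add: A_def)
      moreover have "(norm D)\<^sup>2 \<le> h\<^sup>2"
        using norm_dirichlet_le[of H \<alpha>] H by (simp add: D_def h_def)
      ultimately show ?thesis
        by (meson mult_left_mono mult_right_mono order_trans zero_le_power2)
    qed
    \<comment> \<open>The deficit \<open>h\<^sup>2 - Q\<close> at frequency \<open>0\<close> is in
      turn at most \<open>h\<^sup>2 * A\<close>, hence the factor \<open>2\<close> in
      \<open>V_le\<close>.\<close>
    also have "h\<^sup>2 * A + h\<^sup>2 + 2 * h * s - Q \<le> h\<^sup>2 * A + h\<^sup>2 * (1 - u + u * (h / N)) + 2 * h * s"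
      using Q_ge by (simp add: algebra_simps)
    also have "\<dots> \<le> h\<^sup>2 * A + h\<^sup>2 * A + 2 * h * s"
      using pos by (intro add_mono mult_left_mono) (auto simp: A_def)
    also have "\<dots> = 2 * h\<^sup>2 * (A + s / h)"
      using pos by (simp add: field_simps power2_eq_square)
    finally show ?thesis by simp
  qed
  have G_le: "norm (\<Sum>x\<in>X. G x) \<le> h * sqrt (2 * (N + h) * (A + s / h))"
  proof -
    have "V \<ge> 0"
      by (simp add: V_def sum_nonneg)
    have "(norm (\<Sum>x\<in>X. G x))\<^sup>2 \<le> (N + h - 1) * V"
      using norm_sum_square_le_card_mult[of G X] by (simp add: V_def cardX)
    also have "\<dots> \<le> (N + h) * (2 * h\<^sup>2 * (A + s / h))"
      using V_le \<open>V \<ge> 0\<close> pos by (intro mult_mono) auto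
    also have "\<dots> = h\<^sup>2 * (2 * (N + h) * (A + s / h))"
      by (simp only: mult_ac)
    finally have "norm (\<Sum>x\<in>X. G x) \<le> sqrt (h\<^sup>2 * (2 * (N + h) * (A + s / h)))"
      by (rule real_le_rsqrt)
    then show ?thesis
      using pos by (simp add: real_sqrt_mult[of "h\<^sup>2"])
  qed
  have "(\<Sum>x\<in>X. G x) = of_int H * fS - of_real c * (cnj D * (\<Sum>x\<in>X. e (\<alpha> * of_int x)))"
  proof -
    have "(\<Sum>x\<in>X. window_sum H S \<alpha> x) = of_int H * fS"
      unfolding fS_def using H by (intro sum_window_sum finX X) simp_all
    moreover have "(\<Sum>x\<in>X. of_real c * cnj D * e (\<alpha> * of_int x))
        = of_real c * (cnj D * (\<Sum>x\<in>X. e (\<alpha> * of_int x)))"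
      by (simp only: sum_distrib_left mult.assoc)
    ultimately show ?thesis
      by (simp only: G_def sum_subtractf)
  qed
  then have "of_int H * (fS - of_real c * fN) = (\<Sum>x\<in>X. G x)
      + of_real c * (cnj D * (\<Sum>x\<in>X. e (\<alpha> * of_int x)) - of_int H * fN)"
    by (simp add: algebra_simps)
  then have "h * norm (fS - of_real c * fN) = norm ((\<Sum>x\<in>X. G x)
      + of_real c * (cnj D * (\<Sum>x\<in>X. e (\<alpha> * of_int x)) - of_int H * fN))"
    using pos norm_mult[of "of_int H" "fS - of_real c * fN"] by (simp add: h_def)
  also have "\<dots> \<le> norm (\<Sum>x\<in>X. G x)
      + c * norm (cnj D * (\<Sum>x\<in>X. e (\<alpha> * of_int x)) - of_int H * fN)"
    by (rule order_trans[OF norm_triangle_ineq]) (use pos in \<open>simp add: norm_mult\<close>)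
  also have "\<dots> \<le> h * sqrt (2 * (N + h) * (A + s / h)) + c * (h * h)"
    using G_le norm_dirichlet_mult_sum_diff_le[OF H, of \<alpha> N] pos
    by (intro add_mono mult_left_mono) (auto simp: D_def X_def fN_def h_def)
  also have "\<dots> = h * (sqrt (2 * (N + h) * (A + s / h)) + c * h)"
    by (simp add: algebra_simps)
  finally show ?thesis
    using pos by (simp add: A_def u_def c_def fS_def fN_def)
qed

section \<open>Choice of the window length and constants\<close>

lemma sidon_fourier_bound:
  fixes N :: nat and S :: "int set" and \<alpha> :: real
  assumes S: "S \<subseteq> {1..int N}" "sidon S" and N: "N \<ge> 1"
  shows "norm ((\<Sum>n\<in>S. e (\<alpha> * of_int n))
      - of_real (real (card S) / N) * (\<Sum>n\<in>{1..int N}. e (\<alpha> * of_int n)))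
    \<le> 16 * sqrt (real N) * sqrt (\<bar>real (card S) / sqrt (real N) - 1\<bar> + real N powr (- 1 / 6))"
proof -
  define r where "r = sqrt (real N)"
  define s where "s = real (card S)"
  define \<delta> where "\<delta> = \<bar>s / r - 1\<bar>"
  define \<eta> where "\<eta> = real N powr (- 1 / 6)"
  \<comment> \<open>The exponent \<open>2 / 3\<close> makes \<open>s / h\<close> at most of order
    \<open>N powr (- 1 / 6)\<close>, as \<open>s\<close> is at most of order \<open>sqrt N\<close>;
    \<open>h / N\<close> is then of order \<open>N powr (- 1 / 3)\<close>.\<close>
  define H where "H = \<lceil>real N powr (2 / 3)\<rceil>"
  define h where "h = real_of_int H"
  have r: "r \<ge> 1" "real N = r\<^sup>2"
    using N by (auto simp: r_def)
  have N1: "real N \<ge> 1"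
    using N by simp
  have s: "0 \<le> s" "s \<le> 3 * r"
    using sidon_card_le[OF S N] by (auto simp: s_def r_def)
  have \<eta>: "0 < \<eta>" "\<eta> \<le> 1"
    using N1 powr_mono[of "- 1 / 6" 0 "real N"] by (auto simp: \<eta>_def)
  have r_eq: "r = real N powr (1 / 2)"
    using N by (simp add: r_def powr_half_sqrt)
  have p1: "real N powr (2 / 3) \<ge> 1"
    using N1 by (simp add: ge_one_powr_ge_zero)
  have H: "H \<ge> 1"
    using p1 unfolding H_def by linarith
  have h_ge: "real N powr (2 / 3) \<le> h" and h_le: "h \<le> 2 * real N powr (2 / 3)"
    using p1 unfolding h_def H_def by linarith+
  have "H \<le> int N"
    unfolding H_def using powr_mono[of "2 / 3" 1 "real N"] N1 by (simp add: ceiling_le_iff)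
  then have h_le_N: "h \<le> N"
    unfolding h_def by linarith
  have h1: "h \<ge> 1"
    using H by (simp add: h_def)

  \<comment> \<open>Factor the difference of squares; \<open>s \<le> 3 * r\<close> bounds the second
    factor by \<open>4\<close>.\<close>
  have "\<bar>1 - s\<^sup>2 / N\<bar> = \<delta> * \<bar>s / r + 1\<bar>"
    unfolding \<delta>_def abs_mult[symmetric] r(2) using r(1)
    by (subst abs_minus_commute) (simp add: field_simps power2_eq_square)
  also have "\<dots> \<le> \<delta> * 4"
    using s r by (intro mult_left_mono) (auto simp: \<delta>_def field_simps)
  finally have t1: "\<bar>1 - s\<^sup>2 / N\<bar> \<le> 4 * \<delta>"
    by simp
  have u: "s\<^sup>2 / N \<le> 9"
    using power_mono[OF s(2,1), of 2] r by (simp add: field_simps power_mult_distrib)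
  have "h / N \<le> 2 * (real N powr (2 / 3) / N)"
    using h_le N1 by (simp add: field_simps)
  also have "real N powr (2 / 3) / N = real N powr (- 1 / 3)"
    using N1 powr_diff[of "real N" "2 / 3" 1] by simp
  also have "\<dots> \<le> \<eta>"
    unfolding \<eta>_def using N1 by (intro powr_mono) auto
  finally have hN: "h / N \<le> 2 * \<eta>"
    by simp
  have t2: "s\<^sup>2 / N * (h / N) \<le> 9 * (2 * \<eta>)"
    using u hN h1 \<eta> by (intro mult_mono) auto
  have "s / h \<le> 3 * r / real N powr (2 / 3)"
    using s h_ge p1 r by (intro frac_le) auto
  also have "\<dots> = 3 * (real N powr (1 / 2) / real N powr (2 / 3))"
    by (simp add: r_eq)
  also have "\<dots> = 3 * \<eta>"
    unfolding \<eta>_def powr_diff[symmetric] by simp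
  finally have t3: "s / h \<le> 3 * \<eta>" .
  let ?B = "\<bar>1 - s\<^sup>2 / N\<bar> + s\<^sup>2 / N * (h / N) + s / h"
  have \<delta>: "\<delta> \<ge> 0"
    by (simp add: \<delta>_def)
  \<comment> \<open>The coefficient of \<open>\<eta>\<close> is \<open>9 * 2 + 3 = 21\<close>; that
    of \<open>\<delta>\<close> is only \<open>4\<close>.\<close>
  have "?B \<le> 21 * (\<delta> + \<eta>)"
    using t1 t2 t3 \<delta> by argo
  moreover have "?B \<ge> 0"
    using s h1 by (intro add_nonneg_nonneg mult_nonneg_nonneg divide_nonneg_nonneg) simp_all
  moreover have "2 * (N + h) \<le> 4 * real N"
    using h_le_N by simp
  ultimately have "2 * (N + h) * ?B \<le> (4 * real N) * (21 * (\<delta> + \<eta>))"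
    by (intro mult_mono[of "2 * (N + h)"]) simp_all
  also have "\<dots> = 84 * (real N * (\<delta> + \<eta>))"
    by simp
  \<comment> \<open>\<open>84 = 4 * 21\<close> is rounded up to a square.\<close>
  also have "\<dots> \<le> 10\<^sup>2 * (real N * (\<delta> + \<eta>))"
    using \<eta>(1) \<delta> by (intro mult_right_mono mult_nonneg_nonneg) simp_all
  also have "\<dots> = 10\<^sup>2 * real N * (\<delta> + \<eta>)"
    by simp
  finally have "sqrt (2 * (N + h) * ?B) \<le> sqrt (10\<^sup>2 * real N * (\<delta> + \<eta>))"
    by (rule real_sqrt_le_mono)
  then have main: "sqrt (2 * (N + h) * ?B) \<le> 10 * r * sqrt (\<delta> + \<eta>)"
    by (simp add: real_sqrt_mult r_def)
  have "s / N * h = s * (h / N)"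
    by simp
  also have "\<dots> \<le> (3 * r) * (2 * \<eta>)"
    using s hN h1 by (intro mult_mono) auto
  \<comment> \<open>Since \<open>\<eta> \<le> 1\<close>, \<open>\<eta>\<close> is at most its own
    square root, which gives the end error the shape of \<open>main\<close>.\<close>
  also have "\<dots> \<le> (3 * r) * (2 * sqrt (\<delta> + \<eta>))"
  proof -
    have "\<eta> * \<eta> \<le> \<eta> * 1"
      using \<eta> by (intro mult_left_mono) auto
    then have "\<eta> \<le> sqrt (\<delta> + \<eta>)"
      by (intro real_le_rsqrt) (simp add: \<delta>_def power2_eq_square)
    then show ?thesis
      using r by simp
  qed
  finally have "s / N * h \<le> 6 * r * sqrt (\<delta> + \<eta>)"
    by simp
  \<comment> \<open>The constant \<open>16\<close> is \<open>10\<close> from the window deviation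
    plus \<open>6\<close> from the end error.\<close>
  with main show ?thesis
    using sidon_fourier_deviation[OF S N H, of \<alpha>]
    by (simp add: s_def r_def \<delta>_def \<eta>_def h_def)
qed

theorem theorem1p2:
  shows "\<exists>C::real. C > 0 \<and>
    (\<forall>(N::nat) (S::int set). N \<ge> 1 \<longrightarrow> S \<subseteq> {1..int N} \<longrightarrow> sidon S \<longrightarrow>
      (SUP \<alpha>::real. norm (fourier (indicator S) \<alpha>
          - of_real (real (card S) / real N) * fourier (indicator {1..int N}) \<alpha>))
        \<le> C * sqrt (real N) *
            sqrt (\<bar>real (card S) / sqrt (real N) - 1\<bar> + real N powr (- 1 / 6)))"
proof (intro exI[of _ 16] conjI allI impI)
  fix N :: nat and S :: "int set"
  assume N: "N \<ge> 1" and S: "S \<subseteq> {1..int N}" "sidon S"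
  have "finite S"
    using S(1) finite_subset by blast
  then show "(SUP \<alpha>::real. norm (fourier (indicator S) \<alpha>
          - of_real (real (card S) / real N) * fourier (indicator {1..int N}) \<alpha>))
        \<le> 16 * sqrt (real N) *
            sqrt (\<bar>real (card S) / sqrt (real N) - 1\<bar> + real N powr (- 1 / 6))"
    using sidon_fourier_bound[OF S N] by (intro cSUP_least) (simp_all add: fourier_indicator)
qed simp

end
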